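(* Let $F$, $\mathcal K_\alpha$ be as in the context. For any $\alpha\in\{0,1\}^\infty$, $$\underline{\dim}_B(\mathcal K_\alpha)=\bar\lambda_\alpha\log_5 13+(1-\bar\lambda_\alpha)\log_5 44,\qquad \overline{\dim}_B(\mathcal K_\alpha)=\underline\lambda_\alpha\log_5 13+(1-\underline\lambda_\alpha)\log_5 44.$$ If $\alpha$ is preperiodic, then $\dim_H(\mathcal K_\alpha)=\dim_B(\mathcal K_\alpha)=\lambda_\alpha\log_5 13+(1-\lambda_\alpha)\log_5 44$.
   Context: Let $I=[0,1]^3$. Let $\mathcal D_0=\{(i,2,2),(2,i,2),(2,2,i): i=0,1,2,3,4\}$ (13 elements) and $\mathcal D_1=\{d\in\{0,\ldots,4\}^3:\ \text{at least two coordinates of } d \text{ lie in }\{0,4\}\}$ (44 elements). For $i=0,1$ let $T_i(A)=\bigcup_{d\in\mathcal D_i}\frac{d+A}{5}$ for $A\subset\mathbb R^3$, and $T_{\alpha_1\cdots\alpha_k}=T_{\alpha_1}\circ\cdots\circ T_{\alpha_k}$. For $\alpha=\alpha_1\alpha_2\ldots\in\{0,1\}^\infty$ let $\mathcal K_\alpha=\bigcap_{k\ge1}T_{\alpha_1\cdots\alpha_k}(I)$ (these are the connected components of the fractal cube $F=\frac{F+\mathcal D_0\cup\mathcal D_1}{5}$). For $m\in\mathbb N$ let $\lambda_m$ be the proportion of zeros among $\alpha_1,\ldots,\alpha_m$; set $\bar\lambda_\alpha=\limsup_{m\to\infty}\lambda_m$, $\underline\lambda_\alpha=\liminf_{m\to\infty}\lambda_m$,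 and $\lambda_\alpha=\lim_m\lambda_m$ when it exists (for preperiodic $\alpha$ it exists and equals the proportion of zeros in a period). $\underline{\dim}_B,\overline{\dim}_B,\dim_B,\dim_H$ denote lower/upper box, box and Hausdorff dimension. *)

theory Defs
  imports "HOL-Analysis.Analysis"
begin

definition unit_cube :: "(real^3) set" where
  "unit_cube = {x. \<forall>k. 0 \<le> x$k \<and> x$k \<le> 1}"

definition D0 :: "(real^3) set" where
  "D0 = {d. \<exists>i::nat. i \<le> 4 \<and>
           (d = vector [real i, 2, 2] \<or> d = vector [2, real i, 2] \<or> d = vector [2, 2, real i])}"

definition D1 :: "(real^3) set" where
  "D1 = {d. (\<forall>k. d$k \<in> {0,1,2,3,4}) \<and> card {k. d$k \<in> {0,4}} \<ge> 2}"

definition Dset :: "nat \<Rightarrow> (real^3) set" where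
  "Dset i = (if i = 0 then D0 else D1)"

definition Tmap :: "nat \<Rightarrow> (real^3) set \<Rightarrow> (real^3) set" where
  "Tmap i A = (\<Union>d\<in>Dset i. (\<lambda>x. (1/5) *\<^sub>R (d + x)) ` A)"

text \<open>Tword alpha k = T_{alpha_1} o ... o T_{alpha_k}, where alpha_j is represented by alpha (j-1)\<close>
fun Tword :: "(nat \<Rightarrow> nat) \<Rightarrow> nat \<Rightarrow> (real^3) set \<Rightarrow> (real^3) set" where
  "Tword \<alpha> 0 A = A"
| "Tword \<alpha> (Suc k) A = Tword \<alpha> k (Tmap (\<alpha> k) A)"

definition Kcomp :: "(nat \<Rightarrow> nat) \<Rightarrow> (real^3) set" where
  "Kcomp \<alpha> = (\<Inter>k\<in>{1..}. Tword \<alpha> k unit_cube)"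

definition lam :: "(nat \<Rightarrow> nat) \<Rightarrow> nat \<Rightarrow> real" where
  "lam \<alpha> m = real (card {j. j < m \<and> \<alpha> j = 0}) / real m"

definition preperiodic :: "(nat \<Rightarrow> nat) \<Rightarrow> bool" where
  "preperiodic \<alpha> \<longleftrightarrow> (\<exists>n0 p. p > 0 \<and> (\<forall>n\<ge>n0. \<alpha> (n + p) = \<alpha> n))"

definition cover_number :: "'a::metric_space set \<Rightarrow> real \<Rightarrow> nat" where
  "cover_number F \<delta> = Inf {card C | C. finite C \<and> F \<subseteq> \<Union>C \<and>
                                  (\<forall>U\<in>C. bounded U \<and> diameter U \<le> \<delta>)}"

definition lower_box_dim :: "'a::metric_space set \<Rightarrow> ereal" where
  "lower_box_dim F = Liminf (at_right 0) (\<lambda>\<delta>. ereal (ln (real (cover_number F \<delta>)) / - ln \<delta>))"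

definition upper_box_dim :: "'a::metric_space set \<Rightarrow> ereal" where
  "upper_box_dim F = Limsup (at_right 0) (\<lambda>\<delta>. ereal (ln (real (cover_number F \<delta>)) / - ln \<delta>))"

definition hausdorff_pre :: "real \<Rightarrow> real \<Rightarrow> 'a::metric_space set \<Rightarrow> ennreal" where
  "hausdorff_pre s \<delta> F = (INF U \<in> {U :: nat \<Rightarrow> 'a set. F \<subseteq> (\<Union>i. U i) \<and>
                                  (\<forall>i. bounded (U i) \<and> diameter (U i) \<le> \<delta>)}.
                             (\<Sum>i. ennreal (diameter (U i) powr s)))"

definition hausdorff_measure :: "real \<Rightarrow> 'a::metric_space set \<Rightarrow> ennreal" where
  "hausdorff_measure s F = (SUP \<delta>\<in>{0<..}. hausdorff_pre s \<delta> F)"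

definition hausdorff_dim :: "'a::metric_space set \<Rightarrow> ereal" where
  "hausdorff_dim F = Inf (ereal ` {s. s > 0 \<and> hausdorff_measure s F = 0})"

end

theory Submission
  imports Defs
begin

text \<open>
  Write N(k) for the product of the first k digit set sizes, so that level k consists of N(k) cells
  of side 5^(-k), each of which meets the component. A set of diameter at most 5^(-n) meets at most
  64 cells of level n, hence at most 64 N(k) / N(n) cells of any later level k. Counting level-k cells
  for k large therefore shows that a finite cover by sets of diameter at most 5^(-n_i) satisfies
  1 \<le> 64 (\<Sum>i. 1 / N(n_i)). With constant n_i this bounds covering numbers from below, and after
  reducing countable covers to finite ones by compactness it bounds Hausdorff measures from below.
  The cells themselves give the upper bounds. Hence the lower and upper box dimensions are the
  liminf and limsup of log N(k) / (k log 5), and the Hausdorff dimension always equals the lower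
  box dimension, so that for preperiodic codings, where the limit exists, all three agree.
\<close>

section \<open>Cells\<close>

text \<open>A cell of level k is represented by its minimal corner rescaled by 5^k, an integer vector.\<close>

definition digit_extend :: "(real^3) set \<Rightarrow> (real^3) set \<Rightarrow> (real^3) set" where
  "digit_extend D W = (\<lambda>(w, d). 5 *\<^sub>R w + d) ` (W \<times> D)"

text \<open>Corners at level n + m of all subcells of the level-n cells with corners in W. The start
  level n is a parameter because the coding must be read from position n onwards.\<close>

fun descendants :: "(nat \<Rightarrow> nat) \<Rightarrow> nat \<Rightarrow> nat \<Rightarrow> (real^3) set \<Rightarrow> (real^3) set" where
  "descendants \<alpha> n 0 W = W"
| "descendants \<alpha> n (Suc m) W = digit_extend (Dset (\<alpha> (n + m))) (descendants \<alpha> n m W)"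

definition corners :: "(nat \<Rightarrow> nat) \<Rightarrow> nat \<Rightarrow> (real^3) set" where
  "corners \<alpha> k = descendants \<alpha> 0 k {0}"

definition cell :: "nat \<Rightarrow> real^3 \<Rightarrow> (real^3) set" where
  "cell k z = {x. \<forall>i. z$i \<le> 5^k * x$i \<and> 5^k * x$i \<le> z$i + 1}"

definition cell_count :: "(nat \<Rightarrow> nat) \<Rightarrow> nat \<Rightarrow> nat" where
  "cell_count \<alpha> k = (\<Prod>j<k. card (Dset (\<alpha> j)))"

section \<open>Sizes of the two digit sets\<close>

lemma vec3_eq_iff: "(x::'a^3) = y \<longleftrightarrow> x$1 = y$1 \<and> x$2 = y$2 \<and> x$3 = y$3"
  by (simp add: vec_eq_iff forall_3)

lemma vec3_set_eq_image:
  "{v::real^3. P (v$1) (v$2) (v$3)} = (\<lambda>(a,b,c). vector [a,b,c]) ` {(a,b,c). P a b c}"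
proof -
  have "v = vector [v$1, v$2, v$3]" for v :: "real^3" by (simp add: vec3_eq_iff)
  then show ?thesis by (force simp: image_iff)
qed

lemma inj_vector_3: "inj (\<lambda>(a,b,c). vector [a,b,c] :: real^3)"
  by (auto simp: inj_def vec3_eq_iff)

lemma card_D0: "card D0 = 13"
proof -
  \<comment> \<open>The three lines of five digits share (2,2,2), which leaves 15 - 2 = 13
    triples.\<close>
  let ?S = "{(0,2,2),(1,2,2),(2,2,2),(3,2,2),(4,2,2),(2,0,2),(2,1,2),(2,3,2),(2,4,2),
     (2,2,0),(2,2,1),(2,2,3),(2,2,4)} :: (real \<times> real \<times> real) set"
  have le4: "i \<le> 4 \<longleftrightarrow> i = 0 \<or> i = 1 \<or> i = 2 \<or> i = 3 \<or> i = 4" for i :: nat by linarith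
  have "D0 = (\<lambda>(a,b,c). vector [a,b,c]) ` ?S"
    unfolding D0_def le4 by (auto simp: ex_disj_distrib conj_disj_distribR)
  then have "card D0 = card ?S"
    using card_image[OF inj_on_subset[OF inj_vector_3 subset_UNIV], of ?S] by simp
  then show ?thesis by simp
qed

lemma card_D1: "card D1 = 44"
proof -
  define E B :: "real set" where EB: "E = {0,4}" "B = {1,2,3}"
  have fin: "finite E" "finite B" and disj: "E \<inter> B = {}" and c: "card E = 2" "card B = 3"
    by (auto simp: EB)
  have A: "{0,1,2,3,4} = E \<union> B" by (auto simp: EB)
  let ?P = "\<lambda>a b c. a \<in> E \<union> B \<and> b \<in> E \<union> B \<and> c \<in> E \<union> B \<and>
      (a \<in> E \<and> b \<in> E \<or> a \<in> E \<and> c \<in> E \<or> b \<in> E \<and> c \<in> E)"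
  have two: "2 \<le> card {k::3. Q k} \<longleftrightarrow> Q 1 \<and> Q 2 \<or> Q 1 \<and> Q 3 \<or> Q 2 \<and> Q 3" for Q :: "3 \<Rightarrow> bool"
  proof -
    have "{k::3. Q k} = (if Q 1 then {1} else {}) \<union> (if Q 2 then {2} else {}) \<union> (if Q 3 then {3} else {})"
      (is "_ = ?R")
    proof (rule set_eqI)
      show "k \<in> {k. Q k} \<longleftrightarrow> k \<in> ?R" for k using exhaust_3[of k] by auto
    qed
    then show ?thesis by (auto simp: card_insert_if)
  qed
  let ?S = "{(a,b,c). ?P a b c}"
  have D1: "D1 = {v. ?P (v$1) (v$2) (v$3)}"
    unfolding D1_def A EB(1)[symmetric] two forall_3 by blast
  have "card D1 = card ?S"
    unfolding D1 vec3_set_eq_image[of ?P]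
    by (rule card_image[OF inj_on_subset[OF inj_vector_3 subset_UNIV]])
  \<comment> \<open>The triples are split by their first two entries. If both are extreme, the third
    is free: 2 * 2 * 5 = 20. If exactly one is extreme, the third must be extreme too: 2 * (2 * 3 *
    2) = 24.\<close>
  moreover have "?S = E \<times> E \<times> (E \<union> B) \<union> (E \<times> B \<times> E \<union> B \<times> E \<times> E)"
    unfolding set_eq_iff split_paired_All Un_iff mem_Sigma_iff mem_Collect_eq prod.case
    by (intro allI) argo
  moreover have "card (E \<times> E \<times> (E \<union> B) \<union> (E \<times> B \<times> E \<union> B \<times> E \<times> E)) =
      card (E \<times> E \<times> (E \<union> B)) + (card (E \<times> B \<times> E) + card (B \<times> E \<times> E))"
    using disj fin by (subst card_Un_disjoint, simp, simp, blast, subst card_Un_disjoint, simp, simp, blast, simp)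
  moreover have "card (E \<times> E \<times> (E \<union> B)) + (card (E \<times> B \<times> E) + card (B \<times> E \<times> E)) = 44"
    using disj fin by (simp add: card_cartesian_product card_Un_disjoint c)
  ultimately show ?thesis by (simp only:)
qed

lemma card_Dset: "card (Dset i) = (if i = 0 then 13 else 44)"
  by (simp add: Dset_def card_D0 card_D1)

lemma finite_Dset: "finite (Dset i)"
  using card_Dset[of i] by (metis card.infinite zero_neq_numeral)

lemma Dset_nonempty: "Dset i \<noteq> {}"
  using card_Dset[of i] by (metis card.empty zero_neq_numeral)

lemma Dset_digit: "d \<in> Dset i \<Longrightarrow> d $ k \<in> {0,1,2,3,4}"
proof -
  have le4: "i \<le> 4 \<longleftrightarrow> i = 0 \<or> i = 1 \<or> i = 2 \<or> i = 3 \<or> i = 4" for i :: nat by linarith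
  have "d $ k \<in> {0,1,2,3,4}" if "d \<in> D0"
    using that exhaust_3[of k] unfolding D0_def le4 by auto
  then show "d \<in> Dset i \<Longrightarrow> d $ k \<in> {0,1,2,3,4}"
    by (auto simp: Dset_def D1_def split: if_splits)
qed

section \<open>Counting corners through uniqueness of base-5 digits\<close>

lemma inj_on_digit_extend:
  assumes "\<forall>w\<in>W. \<forall>i. w$i \<in> \<int>"
  shows "inj_on (\<lambda>(w, d). 5 *\<^sub>R w + d) (W \<times> Dset j)"
proof -
  have *: "w$i = w'$i \<and> d$i = d'$i"
    if "w \<in> W" "w' \<in> W" "d \<in> Dset j" "d' \<in> Dset j" "5 *\<^sub>R w + d = 5 *\<^sub>R w' + d'" for w w' d d' i
  proof -
    obtain a b where ab: "w$i = of_int a" "w'$i = of_int b"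
      using assms \<open>w \<in> W\<close> \<open>w' \<in> W\<close> by (metis Ints_cases)
    have d: "d$i \<in> {0,1,2,3,4}" "d'$i \<in> {0,1,2,3,4}" using that Dset_digit by blast+
    have e: "5 * w$i + d$i = 5 * w'$i + d'$i"
      using arg_cong[OF that(5), of "\<lambda>v. v$i"] by simp
    \<comment> \<open>Two digits differ by at most 4, so 5 * |a - b| \<le> 4. Integrality of the
      corners then forces a = b.\<close>
    then have "\<bar>of_int (a - b)\<bar> < (1::real)" using d ab by auto
    then have "a = b" by linarith
    with e ab show ?thesis by simp
  qed
  have "w = w' \<and> d = d'"
    if "w \<in> W" "w' \<in> W" "d \<in> Dset j" "d' \<in> Dset j" "5 *\<^sub>R w + d = 5 *\<^sub>R w' + d'" for w w' d d'
    using *[OF that] by (simp add: vec_eq_iff)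
  then show ?thesis unfolding inj_on_def split_paired_Ball_Sigma prod.case prod.inject by blast
qed

lemma descendants_int:
  assumes "\<forall>w\<in>W. \<forall>i. w$i \<in> \<int>"
  shows "\<forall>w\<in>descendants \<alpha> n m W. \<forall>i. w$i \<in> \<int>"
proof (induction m)
  case (Suc m)
  have "d $ i \<in> \<int>" if "d \<in> Dset j" for d i j using Dset_digit[OF that, of i] by auto
  with Suc show ?case by (auto simp: digit_extend_def intro!: Ints_add Ints_mult)
qed (use assms in simp)

lemma card_descendants:
  assumes "\<forall>w\<in>W. \<forall>i. w$i \<in> \<int>"
  shows "card (descendants \<alpha> n m W) = card W * (\<Prod>j\<in>{n..<n+m}. card (Dset (\<alpha> j)))"
proof (induction m)
  case (Suc m)
  show ?case
    using card_image[OF inj_on_digit_extend[OF descendants_int[OF assms]]] Suc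
    by (simp add: digit_extend_def card_cartesian_product)
qed simp

lemma finite_descendants: "finite W \<Longrightarrow> finite (descendants \<alpha> n m W)"
  by (induction m) (simp_all add: digit_extend_def finite_Dset)

lemma descendants_UN: "descendants \<alpha> n m W = (\<Union>w\<in>W. descendants \<alpha> n m {w})"
  by (induction m) (auto simp: digit_extend_def)

lemma descendants_nonempty: "W \<noteq> {} \<Longrightarrow> descendants \<alpha> n m W \<noteq> {}"
  by (induction m) (simp_all add: digit_extend_def Dset_nonempty)

lemma corners_add: "corners \<alpha> (n + m) = descendants \<alpha> n m (corners \<alpha> n)"
  by (induction m) (simp_all add: corners_def)

lemma corners_Suc: "corners \<alpha> (Suc k) = digit_extend (Dset (\<alpha> k)) (corners \<alpha> k)"
  by (simp add: corners_def)

lemma corners_int: "w \<in> corners \<alpha> k \<Longrightarrow> w$i \<in> \<int>"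
  using descendants_int[of "{0}" \<alpha> 0 k] by (simp add: corners_def)

lemma finite_corners: "finite (corners \<alpha> k)"
  by (simp add: corners_def finite_descendants)

lemma card_corners: "card (corners \<alpha> k) = cell_count \<alpha> k"
  by (simp add: corners_def card_descendants cell_count_def atLeast0LessThan)

lemma cell_count_pos: "cell_count \<alpha> k > 0"
  by (simp add: cell_count_def card_Dset prod_pos)

lemma cell_count_add:
  "cell_count \<alpha> (n + m) = cell_count \<alpha> n * (\<Prod>j\<in>{n..<n+m}. card (Dset (\<alpha> j)))"
  unfolding cell_count_def lessThan_atLeast0
  by (rule prod.atLeastLessThan_concat[symmetric]) auto

section \<open>Geometry of the cells and their relation to the component\<close>

lemma cell_digit_extend:
  assumes "d \<in> Dset j"
  shows "cell (Suc k) (5 *\<^sub>R w + d) \<subseteq> cell k w"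
proof -
  have d: "0 \<le> d$i \<and> d$i \<le> 4" for i using Dset_digit[OF assms, of i] by auto
  have "w$i \<le> 5^k * x$i \<and> 5^k * x$i \<le> w$i + 1"
    if "(5 *\<^sub>R w + d)$i \<le> 5^Suc k * x$i \<and> 5^Suc k * x$i \<le> (5 *\<^sub>R w + d)$i + 1" for x i
  proof -
    have "5 * w$i + d$i \<le> 5 * (5^k * x$i)" "5 * (5^k * x$i) \<le> 5 * w$i + d$i + 1"
      using that by simp_all
    with d[of i] show ?thesis by linarith
  qed
  then show ?thesis unfolding cell_def by blast
qed

lemma cell_descendant:
  "z \<in> descendants \<alpha> n m {w} \<Longrightarrow> cell (n + m) z \<subseteq> cell n w"
proof (induction m arbitrary: z)
  case (Suc m)
  then obtain u d where "u \<in> descendants \<alpha> n m {w}" "d \<in> Dset (\<alpha> (n + m))" "z = 5 *\<^sub>R u + d"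
    by (auto simp: digit_extend_def)
  with Suc.IH cell_digit_extend[of d] show ?case by fastforce
qed simp

text \<open>\<open>Tword\<close> inserts each new map innermost, so the induction hypothesis is
  applied to \<open>Tmap (\<alpha> k) A\<close> and A must stay arbitrary. Pulling the factor 1/5
  out of z + (d + x)/5 produces the next corner 5 z + d.\<close>

lemma Tword_eq: "Tword \<alpha> k A = (\<Union>z\<in>corners \<alpha> k. (\<lambda>x. (1/5)^k *\<^sub>R (z + x)) ` A)"
proof (induction k arbitrary: A)
  case 0
  then show ?case by (simp add: corners_def)
next
  case (Suc k)
  have e: "(1/5)^k *\<^sub>R (z + (1/5) *\<^sub>R (d + x)) = (1/5)^(Suc k) *\<^sub>R (5 *\<^sub>R z + d + x)" for z d x :: "real^3"
    by (simp add: scaleR_add_right algebra_simps)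
  show ?case
    unfolding Tword.simps(2) Suc Tmap_def corners_Suc digit_extend_def
    by (simp add: image_UN image_image e split_def UN_UN_flatten) (force simp: e)
qed

lemma cell_eq_image: "cell k z = (\<lambda>x. (1/5)^k *\<^sub>R (z + x)) ` unit_cube"
proof (intro set_eqI iffI)
  fix x assume "x \<in> cell k z"
  then have "5^k *\<^sub>R x - z \<in> unit_cube" by (auto simp: cell_def unit_cube_def algebra_simps)
  moreover have "x = (1/5)^k *\<^sub>R (z + (5^k *\<^sub>R x - z))" by (simp add: power_divide)
  ultimately show "x \<in> (\<lambda>x. (1/5)^k *\<^sub>R (z + x)) ` unit_cube" by blast
qed (auto simp: cell_def unit_cube_def power_divide)

lemma Tword_unit_cube: "Tword \<alpha> k unit_cube = (\<Union>z\<in>corners \<alpha> k. cell k z)"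
  by (simp add: Tword_eq cell_eq_image)

lemma dist_cell:
  assumes "x \<in> cell k z" "y \<in> cell k z"
  shows "dist x y \<le> 2 * (1/5)^k"
proof -
  have c: "\<bar>(x - y)$i\<bar> \<le> (1/5)^k" for i
  proof -
    have "z$i \<le> 5^k * x$i" "5^k * x$i \<le> z$i + 1" "z$i \<le> 5^k * y$i" "5^k * y$i \<le> z$i + 1"
      using assms by (auto simp: cell_def)
    then have "\<bar>5^k * x$i - 5^k * y$i\<bar> \<le> 1" by linarith
    then have "5^k * \<bar>x$i - y$i\<bar> \<le> 1"
      by (simp flip: right_diff_distrib add: abs_mult)
    then show ?thesis by (simp add: power_divide field_simps)
  qed
  have "norm (x - y) ^ 2 = (\<Sum>i\<in>UNIV. ((x-y)$i)^2)"
    by (simp add: norm_vec_def L2_set_def sum_nonneg)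
  also have "\<dots> \<le> (\<Sum>i\<in>(UNIV::3 set). ((1/5)^k)^2)"
    by (intro sum_mono) (use c in \<open>metis abs_le_square_iff abs_of_nonneg zero_le_divide_1_iff zero_le_numeral zero_le_power\<close>)
  \<comment> \<open>The diagonal of a cube is sqrt 3 times its side; the factor 2 is a rounder
    bound, since 3 \<le> 4.\<close>
  also have "\<dots> \<le> (2 * (1/5)^k)^2" by (simp add: power_mult_distrib)
  finally show ?thesis unfolding dist_norm by (rule power2_le_imp_le) simp
qed

lemma compact_cell: "compact (cell k z)"
proof -
  have "closed (cell k z)"
    unfolding cell_def
    by (intro closed_Collect_all closed_Collect_conj closed_Collect_le continuous_intros)
  moreover have "bounded (cell k z)"
    unfolding bounded_two_points using dist_cell by blast
  ultimately show ?thesis by (simp add: compact_eq_bounded_closed)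
qed

lemma compact_Tword: "compact (Tword \<alpha> k unit_cube)"
  unfolding Tword_unit_cube by (intro compact_UN finite_corners compact_cell)

lemma Tword_antimono: "k \<le> m \<Longrightarrow> Tword \<alpha> m unit_cube \<subseteq> Tword \<alpha> k unit_cube"
proof -
  assume "k \<le> m"
  then obtain r where m: "m = k + r" using le_Suc_ex by blast
  show ?thesis
    unfolding Tword_unit_cube m corners_add[of \<alpha> k r] descendants_UN[of \<alpha> k r "corners \<alpha> k"]
    using cell_descendant by fastforce
qed

lemma compact_Kcomp: "compact (Kcomp \<alpha>)"
  unfolding Kcomp_def by (rule compact_Inter) (auto simp: compact_Tword)

lemma Kcomp_subset: "Kcomp \<alpha> \<subseteq> (\<Union>z\<in>corners \<alpha> k. cell k z)"
proof -
  \<comment> \<open>The detour through level \<open>Suc k\<close> includes k = 0, a level absent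
    from the intersection defining \<open>Kcomp\<close>.\<close>
  have "Kcomp \<alpha> \<subseteq> Tword \<alpha> (Suc k) unit_cube"
    unfolding Kcomp_def by (rule INF_lower) simp
  also have "\<dots> \<subseteq> Tword \<alpha> k unit_cube" by (rule Tword_antimono) simp
  finally show ?thesis by (simp add: Tword_unit_cube)
qed

text \<open>Cantor's intersection theorem: the parts of the cell inside the successive
  approximations are compact and nested, and they are nonempty because no digit set is empty and so
  every cell has descendants at all levels.\<close>

lemma cell_meets_Kcomp:
  assumes "z \<in> corners \<alpha> k"
  shows "cell k z \<inter> Kcomp \<alpha> \<noteq> {}"
proof -
  define F where "F m = cell k z \<inter> Tword \<alpha> (k + m) unit_cube" for m
  have "\<Inter>(range F) \<noteq> {}"
  proof (rule compact_nest)
    show "compact (F m)" for m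
      unfolding F_def by (intro compact_Int compact_cell compact_Tword)
    show "F m \<noteq> {}" for m
    proof -
      obtain u where u: "u \<in> descendants \<alpha> k m {z}" using descendants_nonempty[of "{z}"] by blast
      then have "u \<in> corners \<alpha> (k + m)"
        using assms by (auto simp: corners_add descendants_UN[of \<alpha> k m "corners \<alpha> k"])
      moreover have "cell (k + m) u \<noteq> {}"
      proof -
        have "(0::real^3) \<in> unit_cube" by (simp add: unit_cube_def)
        then show ?thesis by (auto simp: cell_eq_image)
      qed
      ultimately show ?thesis
        unfolding F_def Tword_unit_cube using cell_descendant[OF u] by blast
    qed
    show "F n \<subseteq> F m" if "m \<le> n" for m n
      unfolding F_def using Tword_antimono[of "k+m" "k+n" \<alpha>] that by auto
  qed
  then obtain x where x: "\<And>m. x \<in> F m" by blast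
  have "x \<in> Tword \<alpha> m unit_cube" for m
    using x[of m] Tword_antimono[of m "k+m" \<alpha>] by (auto simp: F_def)
  moreover have "x \<in> cell k z" using x by (auto simp: F_def)
  ultimately show ?thesis by (auto simp: Kcomp_def)
qed

section \<open>Sets of small diameter and the cells they meet\<close>

lemma card_cells_meeting:
  assumes "\<And>x y. x \<in> U \<Longrightarrow> y \<in> U \<Longrightarrow> dist x y \<le> (1/5)^n"
  shows "card {w \<in> corners \<alpha> n. cell n w \<inter> U \<noteq> {}} \<le> 64"
proof (cases "U = {}")
  case False
  then obtain x where x: "x \<in> U" by blast
  let ?A = "{0,1,2,3} :: real set"
  let ?W = "{w \<in> corners \<alpha> n. cell n w \<inter> U \<noteq> {}}"
  \<comment> \<open>With x in U fixed, each coordinate of an admissible corner is an integer between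
    5^n x_i - 2 and 5^n x_i + 1. Here b collects the least such integers; an interval of length 3
    holds at most 4 of them, hence the bound 4^3 = 64.\<close>
  define b :: "real^3" where "b = (\<chi> i. of_int \<lceil>5^n * x$i - 2\<rceil>)"
  have "(w - b)$i \<in> ?A" if w: "w \<in> corners \<alpha> n" "cell n w \<inter> U \<noteq> {}" for w i
  proof -
    obtain y where y: "y \<in> cell n w" "y \<in> U" using w by blast
    have "\<bar>x$i - y$i\<bar> \<le> (1/5)^n"
      using assms[OF x y(2)] component_le_norm_cart[of "x - y" i] by (simp add: dist_norm)
    then have "5^n * \<bar>x$i - y$i\<bar> \<le> 1" by (simp add: power_divide field_simps)
    then have "\<bar>5^n * x$i - 5^n * y$i\<bar> \<le> 1"
      by (simp flip: right_diff_distrib add: abs_mult)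
    moreover have "w$i \<le> 5^n * y$i" "5^n * y$i \<le> w$i + 1" using y(1) by (auto simp: cell_def)
    moreover obtain a where a: "w$i = of_int a" using corners_int[OF w(1)] by (metis Ints_cases)
    ultimately have "5^n * x$i - 2 \<le> of_int a" "of_int a \<le> 5^n * x$i + 1" by linarith+
    then have "0 \<le> a - \<lceil>5^n * x$i - 2\<rceil>" "a - \<lceil>5^n * x$i - 2\<rceil> \<le> 3" by linarith+
    then have "a - \<lceil>5^n * x$i - 2\<rceil> \<in> {0,1,2,3}" by auto
    moreover have "(w - b)$i = of_int (a - \<lceil>5^n * x$i - 2\<rceil>)" by (simp add: b_def a)
    ultimately show ?thesis by auto
  qed
  then have "w \<in> (\<lambda>v. b + v) ` {v. v$1 \<in> ?A \<and> v$2 \<in> ?A \<and> v$3 \<in> ?A}" if "w \<in> ?W" for w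
    using that by (intro image_eqI[where x = "w - b"]) (simp, blast)
  then have "?W \<subseteq> (\<lambda>v. b + v) ` {v. v$1 \<in> ?A \<and> v$2 \<in> ?A \<and> v$3 \<in> ?A}"
    by blast
  also have "\<dots> = (\<lambda>(p, q, r). b + vector [p, q, r]) ` (?A \<times> ?A \<times> ?A)"
    unfolding vec3_set_eq_image[of "\<lambda>p q r. p \<in> ?A \<and> q \<in> ?A \<and> r \<in> ?A"] image_image
    by (intro image_cong) (simp_all only: split_def set_eq_iff mem_Times_iff mem_Collect_eq simp_thms)
  finally have "card ?W \<le> card ((\<lambda>(p, q, r). b + vector [p, q, r]) ` (?A \<times> ?A \<times> ?A))"
    by (intro card_mono) auto
  also have "\<dots> \<le> card (?A \<times> ?A \<times> ?A)" by (intro card_image_le) auto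
  also have "\<dots> = 64" by (simp add: card_cartesian_product)
  finally show ?thesis .
qed simp

lemma finite_cover_bound:
  assumes "finite S" "Kcomp \<alpha> \<subseteq> (\<Union>i\<in>S. U i)"
    and small: "\<And>i x y. i \<in> S \<Longrightarrow> x \<in> U i \<Longrightarrow> y \<in> U i \<Longrightarrow> dist x y \<le> (1/5)^(n i)"
  shows "1 \<le> 64 * (\<Sum>i\<in>S. 1 / real (cell_count \<alpha> (n i)))"
proof -
  \<comment> \<open>The sum serves only as a common level that is at least as deep as every n
    i.\<close>
  define k where "k = (\<Sum>i\<in>S. n i)"
  have nk: "n i \<le> k" if "i \<in> S" for i
    unfolding k_def using assms(1) that by (simp add: member_le_sum)
  define W where "W i = {w \<in> corners \<alpha> (n i). cell (n i) w \<inter> U i \<noteq> {}}" for i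
  \<comment> \<open>Each level-k cell contains a point of the component, which lies in some U i. Its
    ancestor at level n i contains the same point, so it belongs to W i and the cell is counted in X
    i.\<close>
  define X where "X i = descendants \<alpha> (n i) (k - n i) (W i)" for i
  have W_int: "\<forall>w\<in>W i. \<forall>j. w$j \<in> \<int>" for i unfolding W_def using corners_int by blast
  have fin: "finite (X i)" for i
    unfolding X_def W_def by (intro finite_descendants) (simp add: finite_corners)
  have "corners \<alpha> k \<subseteq> (\<Union>i\<in>S. X i)"
  proof
    fix z assume z: "z \<in> corners \<alpha> k"
    then obtain x where x: "x \<in> cell k z" "x \<in> Kcomp \<alpha>" using cell_meets_Kcomp by blast
    then obtain i where i: "i \<in> S" "x \<in> U i" using assms(2) by blast
    have k: "k = n i + (k - n i)" using nk[OF i(1)] by simp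
    have "z \<in> descendants \<alpha> (n i) (k - n i) (corners \<alpha> (n i))"
      using z by (subst (asm) k) (simp only: corners_add)
    then obtain w where w: "w \<in> corners \<alpha> (n i)" "z \<in> descendants \<alpha> (n i) (k - n i) {w}"
      unfolding descendants_UN[of \<alpha> "n i" "k - n i" "corners \<alpha> (n i)"] by blast
    have "x \<in> cell (n i) w" using cell_descendant[OF w(2)] k x(1) by auto
    then have "w \<in> W i" using w i by (auto simp: W_def)
    then show "z \<in> (\<Union>i\<in>S. X i)"
      using w i unfolding X_def descendants_UN[of \<alpha> _ _ "W _"] by blast
  qed
  then have "card (corners \<alpha> k) \<le> card (\<Union>i\<in>S. X i)"
    using assms(1) fin by (intro card_mono) auto
  also have "\<dots> \<le> (\<Sum>i\<in>S. card (X i))" by (rule card_UN_le[OF assms(1)])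
  finally have "real (cell_count \<alpha> k) \<le> (\<Sum>i\<in>S. real (card (X i)))"
    unfolding card_corners by (simp flip: of_nat_sum)
  also have "\<dots> \<le> (\<Sum>i\<in>S. 64 * real (cell_count \<alpha> k) / real (cell_count \<alpha> (n i)))"
  proof (rule sum_mono)
    fix i assume i: "i \<in> S"
    have "card (W i) \<le> 64" unfolding W_def by (intro card_cells_meeting small[OF i])
    then have "card (X i) * cell_count \<alpha> (n i) \<le> 64 * cell_count \<alpha> k"
      using cell_count_add[of \<alpha> "n i" "k - n i"] nk[OF i]
      by (simp add: X_def card_descendants[OF W_int])
    then have "real (card (X i)) * real (cell_count \<alpha> (n i)) \<le> 64 * real (cell_count \<alpha> k)"
      by (metis of_nat_le_iff of_nat_mult of_nat_numeral)
    then show "real (card (X i)) \<le> 64 * real (cell_count \<alpha> k) / real (cell_count \<alpha> (n i))"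
      using cell_count_pos[of \<alpha> "n i"] by (simp add: field_simps)
  qed
  also have "\<dots> = real (cell_count \<alpha> k) * (64 * (\<Sum>i\<in>S. 1 / real (cell_count \<alpha> (n i))))"
    by (simp add: sum_distrib_left mult_ac)
  finally show ?thesis using cell_count_pos[of \<alpha> k] by simp
qed

section \<open>Box dimensions\<close>

text \<open>The logarithm of the number of level-k cells to base 5^k, the inverse of their side. At
  k = 0 division by zero gives the value 0.\<close>

definition growth_exponent :: "(nat \<Rightarrow> nat) \<Rightarrow> nat \<Rightarrow> real" where
  "growth_exponent \<alpha> k = ln (real (cell_count \<alpha> k)) / (real k * ln 5)"

text \<open>For 0 < \<delta> < 1 this is the largest k with \<delta> \<le> 5^(-k).\<close>

definition scale_index :: "real \<Rightarrow> nat" where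
  "scale_index \<delta> = nat \<lfloor>- log 5 \<delta>\<rfloor>"

lemma bounded_cell: "bounded (cell k z)"
  by (simp add: compact_cell compact_imp_bounded)

lemma diameter_cell: "diameter (cell k z) \<le> 2 * (1/5)^k"
  by (rule diameter_le) (auto simp: dist_cell simp flip: dist_norm)

lemma cover_number_le:
  assumes "2 * (1/5)^k \<le> \<delta>"
  shows "cover_number (Kcomp \<alpha>) \<delta> \<le> cell_count \<alpha> k"
proof -
  let ?C = "cell k ` corners \<alpha> k"
  have "cover_number (Kcomp \<alpha>) \<delta> \<le> card ?C"
    unfolding cover_number_def
    using Kcomp_subset[of \<alpha> k] finite_corners[of \<alpha> k] bounded_cell order_trans[OF diameter_cell assms]
    by (intro cInf_lower) (auto intro!: exI[of _ ?C])
  also have "\<dots> \<le> cell_count \<alpha> k"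
    using card_image_le[OF finite_corners] by (simp flip: card_corners)
  finally show ?thesis .
qed

lemma cell_count_le_cover_number:
  assumes "0 < \<delta>" "\<delta> \<le> (1/5)^k"
  shows "cell_count \<alpha> k \<le> 64 * cover_number (Kcomp \<alpha>) \<delta>"
proof -
  let ?S = "{card C | C. finite C \<and> Kcomp \<alpha> \<subseteq> \<Union>C \<and> (\<forall>U\<in>C. bounded U \<and> diameter U \<le> \<delta>)}"
  \<comment> \<open>An infimum of naturals is attained once the set is nonempty. Cells of a level m
    with diameter below \<delta> supply a member, so an optimal cover C exists.\<close>
  obtain m where m: "(1/5)^m < \<delta>/2" using real_arch_pow_inv[of "\<delta>/2" "1/5"] assms by auto
  have "card (cell m ` corners \<alpha> m) \<in> ?S"
    using Kcomp_subset[of \<alpha> m] finite_corners[of \<alpha> m] bounded_cell order_trans[OF diameter_cell, of m \<delta>] m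
    by (auto intro!: exI[of _ "cell m ` corners \<alpha> m"])
  then have "Inf ?S \<in> ?S" by (intro Inf_nat_def1) blast
  then obtain C where C: "cover_number (Kcomp \<alpha>) \<delta> = card C" "finite C" "Kcomp \<alpha> \<subseteq> \<Union>C"
      "\<And>U. U \<in> C \<Longrightarrow> bounded U \<and> diameter U \<le> \<delta>"
    unfolding cover_number_def by blast
  have "1 \<le> 64 * (\<Sum>U\<in>C. 1 / real (cell_count \<alpha> k))"
  proof (rule finite_cover_bound[of C _ "\<lambda>U. U"])
    show "dist x y \<le> (1/5)^k" if "U \<in> C" "x \<in> U" "y \<in> U" for U x y
      using diameter_bounded_bound[of U x y] C(4)[OF that(1)] that assms by linarith
  qed (use C in auto)
  then have "real (cell_count \<alpha> k) \<le> 64 * real (card C)"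
    using cell_count_pos[of \<alpha> k] by (simp add: field_simps)
  then show ?thesis unfolding C(1) by linarith
qed

lemma cell_count_le_power: "cell_count \<alpha> k \<le> 44 ^ k"
proof -
  have "cell_count \<alpha> k \<le> (\<Prod>j<k. 44)"
    unfolding cell_count_def by (rule prod_mono) (simp add: card_Dset)
  then show ?thesis by simp
qed

lemma cell_count_add2_le: "cell_count \<alpha> (k + 2) \<le> 1936 * cell_count \<alpha> k"
proof -
  have "card (Dset (\<alpha> k)) * card (Dset (\<alpha> (Suc k))) \<le> 44 * 44"
    by (rule mult_mono) (simp_all add: card_Dset)
  then show ?thesis by (simp add: cell_count_def)
qed

section \<open>From continuous scales to discrete levels\<close>

lemma scale_index_bounds:
  assumes "0 < \<delta>" "\<delta> < 1"
  shows "real (scale_index \<delta>) * ln 5 \<le> - ln \<delta>" "- ln \<delta> < (real (scale_index \<delta>) + 1) * ln 5"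
    "\<delta> \<le> (1/5)^scale_index \<delta>" "(1/5)^(scale_index \<delta> + 1) < \<delta>"
proof -
  let ?k = "scale_index \<delta>"
  have p: "ln (5::real) > 0" by simp
  have "- log 5 \<delta> \<ge> 0" using assms by simp
  then have "real ?k \<le> - log 5 \<delta>" "- log 5 \<delta> < real ?k + 1"
    unfolding scale_index_def by linarith+
  then show 1: "real ?k * ln 5 \<le> - ln \<delta>" and 2: "- ln \<delta> < (real ?k + 1) * ln 5"
    using p by (simp_all add: log_def field_simps)
  have l: "ln ((1/5::real)^n) = - real n * ln 5" for n by (simp add: ln_realpow ln_div)
  have "ln \<delta> \<le> ln ((1/5)^?k)" using 1 unfolding l by simp
  then show "\<delta> \<le> (1/5)^?k" using assms by (subst (asm) ln_le_cancel_iff) auto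
  have "ln ((1/5)^(?k+1)) < ln \<delta>" using 2 unfolding l by (simp add: algebra_simps)
  then show "(1/5)^(?k+1) < \<delta>" using assms by (subst (asm) ln_less_cancel_iff) auto
qed

lemma scale_index_power: "scale_index ((1/5)^n) = n"
  by (simp add: scale_index_def log_nat_power log_divide)

lemma filterlim_minus_ln: "filterlim (\<lambda>\<delta>::real. - ln \<delta>) at_top (at_right 0)"
  using ln_at_0 by (simp add: filterlim_uminus_at_bot)

text \<open>This turns limits inferior and superior over \<delta> into those over levels. The index
  tends to infinity as \<delta> tends to 0, and the scales 5^(-n) realise every index n.\<close>

lemma filtermap_scale_index: "filtermap scale_index (at_right 0) = sequentially"
proof (rule filter_eqI)
  fix P
  show "eventually P (filtermap scale_index (at_right 0)) \<longleftrightarrow> eventually P sequentially"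
  proof
    assume "eventually P (filtermap scale_index (at_right 0))"
    then obtain b where b: "b > 0" "\<And>y. 0 < y \<Longrightarrow> y < b \<Longrightarrow> P (scale_index y)"
      unfolding eventually_filtermap eventually_at_right_field by auto
    have "eventually (\<lambda>n. (1/5::real)^n < b) sequentially"
      by (rule order_tendstoD[OF LIMSEQ_realpow_zero]) (use b in auto)
    then show "eventually P sequentially"
      by eventually_elim (use b(2) scale_index_power in \<open>metis zero_less_divide_1_iff zero_less_numeral zero_less_power\<close>)
  next
    assume "eventually P sequentially"
    then obtain N where N: "\<And>n. n \<ge> N \<Longrightarrow> P n" unfolding eventually_sequentially by blast
    have "eventually (\<lambda>\<delta>. - ln \<delta> \<ge> real (N + 1) * ln 5) (at_right 0)"
      using filterlim_minus_ln unfolding filterlim_at_top by blast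
    moreover have "eventually (\<lambda>\<delta>. \<delta> \<in> {0<..<1::real}) (at_right 0)"
      by (rule eventually_at_right_real) simp
    ultimately have "eventually (\<lambda>\<delta>. N \<le> scale_index \<delta>) (at_right 0)"
    proof eventually_elim
      case (elim \<delta>)
      then have "real (N + 1) * ln 5 < (real (scale_index \<delta>) + 1) * ln 5"
        using scale_index_bounds(2)[of \<delta>] by (intro le_less_trans[OF elim(1)]) auto
      then have "real (N + 1) < real (scale_index \<delta>) + 1"
        by (rule mult_right_less_imp_less) simp
      then show ?case by simp
    qed
    then show "eventually P (filtermap scale_index (at_right 0))"
      unfolding eventually_filtermap by eventually_elim (rule N)
  qed
qed

text \<open>With N cells at level k and L = - ln \<delta>, the covering number lies between N / 64
  and 1936 N, so its logarithm is within 2 ln 44 of ln N. Replacing k ln 5 by L in the denominator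
  costs at most another ln 44 / L, and 3 ln 44 / L tends to 0.\<close>

lemma box_ratio_asymptotic:
  "((\<lambda>\<delta>. ln (real (cover_number (Kcomp \<alpha>) \<delta>)) / - ln \<delta> - growth_exponent \<alpha> (scale_index \<delta>))
      \<longlongrightarrow> 0) (at_right 0)"
proof (rule Lim_null_comparison)
  show "((\<lambda>\<delta>. (3 * ln 44) / - ln \<delta>) \<longlongrightarrow> 0) (at_right (0::real))"
    by (rule real_tendsto_divide_at_top[OF tendsto_const filterlim_minus_ln])
  \<comment> \<open>Scales below 1/5 have index at least 1, which keeps the denominator k ln 5
    positive.\<close>
  have "eventually (\<lambda>\<delta>. \<delta> \<in> {0<..<1/5::real}) (at_right 0)"
    by (rule eventually_at_right_real) simp
  then show "eventually (\<lambda>\<delta>. norm (ln (real (cover_number (Kcomp \<alpha>) \<delta>)) / - ln \<delta>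
      - growth_exponent \<alpha> (scale_index \<delta>)) \<le> (3 * ln 44) / - ln \<delta>) (at_right 0)"
  proof eventually_elim
    case (elim \<delta>)
    then have \<delta>: "0 < \<delta>" "\<delta> < 1" "\<delta> < 1/5" by auto
    define k where "k = scale_index \<delta>"
    define L where "L = - ln \<delta>"
    define N where "N = real (cell_count \<alpha> k)"
    define c where "c = real (cover_number (Kcomp \<alpha>) \<delta>)"
    note b = scale_index_bounds[OF \<delta>(1,2), folded k_def L_def]
    have "k \<noteq> 0"
    proof
      assume "k = 0"
      then show False using b(4) \<delta>(3) by simp
    qed
    then have k: "real k > 0" by simp
    have l5: "ln (5::real) > 0" by simp
    have L: "L > 0" using \<delta> by (simp add: L_def)
    have N: "N \<ge> 1" using cell_count_pos[of \<alpha> k] unfolding N_def by linarith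
    have up: "N \<le> 64 * c"
      using cell_count_le_cover_number[OF \<delta>(1) b(3), of \<alpha>] unfolding N_def c_def by linarith
    \<comment> \<open>One extra level brings the side below \<delta>; the second absorbs the factor
      2 in the diameter bound. Two levels multiply the count by at most 44^2 = 1936.\<close>
    have "2 * (1/5)^(k+2) \<le> \<delta>" using b(4) \<delta>(1) by (simp add: power_add)
    then have "cover_number (Kcomp \<alpha>) \<delta> \<le> 1936 * cell_count \<alpha> k"
      using cover_number_le cell_count_add2_le order_trans by blast
    then have lo: "c \<le> 1936 * N" unfolding N_def c_def by linarith
    have c: "c > 0" using up N by linarith
    have two: "ln (1936::real) = 2 * ln 44" using ln_realpow[of 44 2] by simp
    have "ln c \<le> ln (1936 * N)" using lo c by simp
    then have 1: "ln c - ln N \<le> 2 * ln 44" using N two by (simp add: ln_mult)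
    \<comment> \<open>The constant 64 is weakened to 1936 so that both directions carry the same
      error 2 ln 44.\<close>
    have "ln N \<le> ln (1936 * c)" using up N c by simp
    then have 2: "ln N - ln c \<le> 2 * ln 44" using c two by (simp add: ln_mult)
    have A: "\<bar>(ln c - ln N) / L\<bar> \<le> 2 * ln 44 / L"
      using 1 2 L by (simp add: divide_right_mono)
    have "N \<le> 44^k"
      using cell_count_le_power[of \<alpha> k] unfolding N_def
      by (metis of_nat_le_iff of_nat_numeral of_nat_power)
    then have "ln N \<le> ln (44^k)" using N by simp
    then have lnN: "ln N \<le> k * ln 44" "0 \<le> ln N" using N by (simp_all add: ln_realpow)
    have D: "ln N / (k * ln 5) - ln N / L = ln N * (L - k * ln 5) / (k * ln 5 * L)"
      using k L l5 by (simp add: field_simps)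
    \<comment> \<open>There are at most 44^k cells, and L exceeds k ln 5 by at most ln 5.\<close>
    have "ln N * (L - k * ln 5) \<le> (k * ln 44) * ln 5"
      using lnN b(1,2) by (intro mult_mono) (auto simp: algebra_simps)
    then have "ln N * (L - k * ln 5) / (k * ln 5 * L) \<le> (k * ln 44) * ln 5 / (k * ln 5 * L)"
      using k L l5 by (intro divide_right_mono) auto
    also have "\<dots> = ln 44 / L" using k l5 by simp
    finally have B1: "ln N / (k * ln 5) - ln N / L \<le> ln 44 / L" using D by simp
    have B2: "0 \<le> ln N / (k * ln 5) - ln N / L"
      unfolding D using lnN b(1) k L l5 by (intro divide_nonneg_nonneg mult_nonneg_nonneg) auto
    have "ln c / L - ln N / (k * ln 5) = (ln c - ln N) / L - (ln N / (k * ln 5) - ln N / L)"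
      by (simp add: diff_divide_distrib)
    then have "\<bar>ln c / L - ln N / (k * ln 5)\<bar> \<le> 2 * ln 44 / L + ln 44 / L"
      using A B1 B2 by linarith
    also have "\<dots> = (3 * ln 44) / L" by (simp add: field_simps)
    finally show ?case
      unfolding growth_exponent_def real_norm_def c_def N_def L_def k_def by simp
  qed
qed

lemma Liminf_filtermap: "Liminf (filtermap k F) h = Liminf F (\<lambda>x. h (k x))"
  for h :: "'b \<Rightarrow> 'c::complete_linorder"
proof -
  have "c \<le> Liminf (filtermap k F) h \<longleftrightarrow> c \<le> Liminf F (\<lambda>x. h (k x))" for c
    by (simp add: le_Liminf_iff eventually_filtermap)
  then show ?thesis by (meson order.antisym order.refl)
qed

lemma Limsup_filtermap: "Limsup (filtermap k F) h = Limsup F (\<lambda>x. h (k x))"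
  for h :: "'b \<Rightarrow> 'c::complete_linorder"
proof -
  have "Limsup (filtermap k F) h \<le> c \<longleftrightarrow> Limsup F (\<lambda>x. h (k x)) \<le> c" for c
    by (simp add: Limsup_le_iff eventually_filtermap)
  then show ?thesis by (meson order.antisym order.refl)
qed

text \<open>A value z strictly between y and the limit inferior of u leaves a gap, which eventually
  exceeds u - v.\<close>

lemma Liminf_le_of_diff_tendsto_0:
  fixes u v :: "'a \<Rightarrow> real"
  assumes "((\<lambda>x. u x - v x) \<longlongrightarrow> 0) F"
  shows "Liminf F (\<lambda>x. ereal (u x)) \<le> Liminf F (\<lambda>x. ereal (v x))"
  unfolding le_Liminf_iff
proof (intro allI impI)
  fix y assume "y < Liminf F (\<lambda>x. ereal (u x))"
  then obtain z where z: "y < z" "z < Liminf F (\<lambda>x. ereal (u x))" using dense by blast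
  have ev: "eventually (\<lambda>x. z < ereal (u x)) F" using less_LiminfD[OF z(2)] .
  show "eventually (\<lambda>x. y < ereal (v x)) F"
  proof (cases y)
    case (real r)
    show ?thesis
    proof (cases z)
      case (real t)
      then have "r < t" using z \<open>y = ereal r\<close> by simp
      then have "eventually (\<lambda>x. u x - v x < t - r) F" by (intro order_tendstoD[OF assms]) simp
      with ev show ?thesis by eventually_elim (use real \<open>y = ereal r\<close> in simp)
    next
      case PInf
      then show ?thesis using z by simp
    next
      case MInf
      then show ?thesis using z by simp
    qed
  qed (use z in auto)
qed

lemma Liminf_eq_of_diff_tendsto_0:
  fixes u v :: "'a \<Rightarrow> real"
  assumes "((\<lambda>x. u x - v x) \<longlongrightarrow> 0) F"
  shows "Liminf F (\<lambda>x. ereal (u x)) = Liminf F (\<lambda>x. ereal (v x))"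
proof (rule antisym)
  have "((\<lambda>x. v x - u x) \<longlongrightarrow> 0) F" using tendsto_minus[OF assms] by simp
  then show "Liminf F (\<lambda>x. ereal (v x)) \<le> Liminf F (\<lambda>x. ereal (u x))"
    by (rule Liminf_le_of_diff_tendsto_0)
qed (rule Liminf_le_of_diff_tendsto_0[OF assms])

lemma Limsup_eq_of_diff_tendsto_0:
  fixes u v :: "'a \<Rightarrow> real"
  assumes "((\<lambda>x. u x - v x) \<longlongrightarrow> 0) F"
  shows "Limsup F (\<lambda>x. ereal (u x)) = Limsup F (\<lambda>x. ereal (v x))"
proof -
  have "((\<lambda>x. - u x - - v x) \<longlongrightarrow> 0) F" using tendsto_minus[OF assms] by simp
  from Liminf_eq_of_diff_tendsto_0[OF this]
  have "Liminf F (\<lambda>x. - ereal (u x)) = Liminf F (\<lambda>x. - ereal (v x))" by simp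
  then show ?thesis unfolding ereal_Liminf_uminus by simp
qed

lemma lower_box_dim_Kcomp:
  "lower_box_dim (Kcomp \<alpha>) = liminf (\<lambda>k. ereal (growth_exponent \<alpha> k))"
  unfolding lower_box_dim_def Liminf_eq_of_diff_tendsto_0[OF box_ratio_asymptotic]
    filtermap_scale_index[symmetric] Liminf_filtermap ..

lemma upper_box_dim_Kcomp:
  "upper_box_dim (Kcomp \<alpha>) = limsup (\<lambda>k. ereal (growth_exponent \<alpha> k))"
  unfolding upper_box_dim_def Limsup_eq_of_diff_tendsto_0[OF box_ratio_asymptotic]
    filtermap_scale_index[symmetric] Limsup_filtermap ..

section \<open>Hausdorff dimension\<close>

text \<open>Selects the level matching a covering set of diameter d. For d > 0 the scale 5^(-n) is
  at most 5 d; for d = 0 no scale is comparable to d, and \<eta> pays for the set. Strictness of d <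
  5^(-n) leaves room to enlarge the set to an open one.\<close>

lemma exists_scale_power:
  fixes d s \<eta> :: real
  assumes "0 \<le> d" "d < 1" "s > 0" "\<eta> > 0"
  shows "\<exists>n. d < (1/5)^n \<and> ((1/5)^n) powr s \<le> 5 powr s * d powr s + \<eta>"
proof (cases "d = 0")
  case True
  have "((1/5::real) powr s) < 1" using powr_less_mono2[of s "1/5" 1] assms by simp
  then obtain n where "((1/5::real) powr s)^n < \<eta>" using real_arch_pow_inv assms(4) by blast
  moreover have "((1/5::real)^n) powr s = ((1/5) powr s)^n"
    by (simp add: powr_powr mult.commute flip: powr_realpow)
  ultimately have "((1/5)^n) powr s \<le> \<eta>" by simp
  with True show ?thesis by auto
next
  case False
  then have d: "d > 0" using assms by simp
  define m where "m = (LEAST m. (1/5)^m \<le> d)"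
  obtain j where "(1/5)^j < d" using real_arch_pow_inv[of d "1/5"] d by auto
  then have m: "(1/5)^m \<le> d" unfolding m_def by (rule LeastI[of "\<lambda>m. (1/5)^m \<le> d", OF less_imp_le])
  have "m \<noteq> 0" using m assms by (intro notI) simp
  then obtain n where n: "m = Suc n" by (cases m) auto
  have "\<not> (1/5)^n \<le> d" using not_less_Least[of n "\<lambda>m. (1/5)^m \<le> d"] n unfolding m_def by simp
  moreover have "((1/5)^n) powr s \<le> (5 * d) powr s" using m n assms by (intro powr_mono2) auto
  ultimately show ?thesis using assms d by (intro exI[of _ n]) (auto simp: powr_mult)
qed

text \<open>Measure zero would give a countable cover of tiny total cost. Thickened to open sets, it
  has a finite subcover by compactness, and the growth hypothesis turns the small cost into a
  contradiction with \<open>finite_cover_bound\<close>.\<close>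

lemma hausdorff_measure_Kcomp_nonzero:
  assumes s: "s > 0" and C: "C > 0"
    and growth: "\<And>n. 1 / real (cell_count \<alpha> n) \<le> C * ((1/5)^n) powr s"
  shows "hausdorff_measure s (Kcomp \<alpha>) \<noteq> 0"
proof
  assume "hausdorff_measure s (Kcomp \<alpha>) = 0"
  \<comment> \<open>A mesh below 1 is what \<open>exists_scale_power\<close> asks for.\<close>
  then have "hausdorff_pre s (1/2) (Kcomp \<alpha>) = 0"
    unfolding hausdorff_measure_def by (auto simp: SUP_eq_iff SUP_bot_conv bot_ennreal)
  \<comment> \<open>Both constants are tuned so that the two terms of the final estimate equal 1/4
    each; the weights (1/2)^i contribute the factor 2 to the second one.\<close>
  define c where "c = 1 / (256 * C * 5 powr s)"
  define e where "e = 1 / (512 * C)"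
  have pos: "c > 0" "e > 0" using C by (simp_all add: c_def e_def)
  have "hausdorff_pre s (1/2) (Kcomp \<alpha>) < ennreal c"
    using \<open>hausdorff_pre s (1/2) (Kcomp \<alpha>) = 0\<close> pos by simp
  then obtain U :: "nat \<Rightarrow> (real^3) set" where U: "Kcomp \<alpha> \<subseteq> (\<Union>i. U i)"
      "\<And>i. bounded (U i)" "\<And>i. diameter (U i) \<le> 1/2"
      "(\<Sum>i. ennreal (diameter (U i) powr s)) < ennreal c"
    unfolding hausdorff_pre_def INF_less_iff by blast
  have "\<exists>n. diameter (U i) < (1/5)^n \<and>
      ((1/5)^n) powr s \<le> 5 powr s * diameter (U i) powr s + e * (1/2)^i" for i
    using exists_scale_power[of "diameter (U i)" s "e * (1/2)^i"] U(2,3)[of i] s pos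
    by (auto simp: diameter_ge_0)
  then obtain n where n: "\<And>i. diameter (U i) < (1/5)^(n i)"
      "\<And>i. ((1/5)^(n i)) powr s \<le> 5 powr s * diameter (U i) powr s + e * (1/2)^i"
    by metis
  \<comment> \<open>Thickening by half of the gap on either side keeps mutual distances at most
    5^(-n i).\<close>
  define r where "r i = ((1/5)^(n i) - diameter (U i)) / 2" for i
  have r: "r i > 0" for i using n(1)[of i] by (simp add: r_def)
  define V where "V i = (\<Union>x\<in>U i. ball x (r i))" for i
  have "Kcomp \<alpha> \<subseteq> (\<Union>i\<in>UNIV. V i)"
  proof
    fix x assume "x \<in> Kcomp \<alpha>"
    then obtain i where "x \<in> U i" using U(1) by blast
    then show "x \<in> (\<Union>i\<in>UNIV. V i)" using centre_in_ball[of x "r i"] r[of i] unfolding V_def by blast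
  qed
  then obtain S where S: "finite S" "Kcomp \<alpha> \<subseteq> (\<Union>i\<in>S. V i)"
    by (rule compactE_image[OF compact_Kcomp, rotated]) (auto simp: V_def)
  have "1 \<le> 64 * (\<Sum>i\<in>S. 1 / real (cell_count \<alpha> (n i)))"
  proof (rule finite_cover_bound[OF S])
    fix i x y assume "x \<in> V i" "y \<in> V i"
    then obtain p q where pq: "p \<in> U i" "q \<in> U i" "dist p x < r i" "dist q y < r i"
      unfolding V_def by auto
    have "dist p q \<le> diameter (U i)" using diameter_bounded_bound U(2) pq by blast
    moreover have "dist x y \<le> dist p x + dist p q + dist q y"
      using dist_triangle[of x y p] dist_triangle[of p y q] by (simp add: dist_commute)
    ultimately show "dist x y \<le> (1/5)^(n i)" using pq by (simp add: r_def)
  qed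
  also have "\<dots> \<le> 64 * (\<Sum>i\<in>S. C * (5 powr s * diameter (U i) powr s + e * (1/2)^i))"
    using order_trans[OF growth mult_left_mono[OF n(2)]] C by (intro mult_left_mono sum_mono) auto
  also have "\<dots> = 64 * C * 5 powr s * (\<Sum>i\<in>S. diameter (U i) powr s) + 64 * C * e * (\<Sum>i\<in>S. (1/2)^i)"
    by (simp add: sum_distrib_left[symmetric] sum.distrib distrib_left mult.assoc)
  also have "\<dots> \<le> 64 * C * 5 powr s * c + 64 * C * e * 2"
  proof (intro add_mono mult_left_mono)
    have "ennreal (\<Sum>i\<in>S. diameter (U i) powr s) = (\<Sum>i\<in>S. ennreal (diameter (U i) powr s))"
      by (rule sum_ennreal[symmetric]) simp
    also have "\<dots> \<le> (\<Sum>i. ennreal (diameter (U i) powr s))"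
      using S(1) by (intro sum_le_suminf) auto
    also have "\<dots> \<le> ennreal c" using U(4) by simp
    finally show "(\<Sum>i\<in>S. diameter (U i) powr s) \<le> c" using pos by simp
    have "(\<Sum>i\<in>S. (1/2::real)^i) \<le> (\<Sum>i. (1/2)^i)"
      using S(1) by (intro sum_le_suminf summable_geometric) auto
    then show "(\<Sum>i\<in>S. (1/2::real)^i) \<le> 2" by (simp add: suminf_geometric)
  qed (use C pos in auto)
  also have "\<dots> < 1" using C by (simp add: c_def e_def)
  finally show False by simp
qed

lemma hausdorff_pre_Kcomp_le:
  assumes "s > 0" "2 * (1/5)^n \<le> \<delta>"
  shows "hausdorff_pre s \<delta> (Kcomp \<alpha>) \<le> ennreal (real (cell_count \<alpha> n) * (2 * (1/5)^n) powr s)"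
proof -
  let ?N = "cell_count \<alpha> n"
  obtain h where h: "bij_betw h {0..<?N} (corners \<alpha> n)"
    using ex_bij_betw_nat_finite[OF finite_corners, of \<alpha> n] unfolding card_corners by blast
  \<comment> \<open>The finite family of cells is padded with empty sets, whose cost
    \<open>0 powr s\<close> is 0.\<close>
  define U where "U i = (if i < ?N then cell n (h i) else {})" for i
  have "Kcomp \<alpha> \<subseteq> (\<Union>i. U i)"
  proof
    fix x assume "x \<in> Kcomp \<alpha>"
    then obtain z where z: "z \<in> corners \<alpha> n" "x \<in> cell n z" using Kcomp_subset by blast
    then obtain i where "i < ?N" "z = h i"
      using bij_betw_imp_surj_on[OF h] by (metis atLeastLessThan_iff imageE)
    with z show "x \<in> (\<Union>i. U i)" by (auto simp: U_def)
  qed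
  moreover have "0 \<le> \<delta>" using order_trans[OF _ assms(2), of 0] by simp
  then have "bounded (U i) \<and> diameter (U i) \<le> \<delta>" for i
    using order_trans[OF diameter_cell assms(2)] bounded_cell by (simp add: U_def)
  ultimately have "hausdorff_pre s \<delta> (Kcomp \<alpha>) \<le> (\<Sum>i. ennreal (diameter (U i) powr s))"
    unfolding hausdorff_pre_def by (intro INF_lower) blast
  also have "\<dots> = (\<Sum>i<?N. ennreal (diameter (U i) powr s))"
    by (rule suminf_finite) (auto simp: U_def)
  also have "\<dots> \<le> (\<Sum>i<?N. ennreal ((2 * (1/5)^n) powr s))"
    using assms diameter_cell bounded_cell
    by (intro sum_mono ennreal_leI powr_mono2) (auto simp: U_def diameter_ge_0)
  also have "\<dots> = ennreal (real ?N * (2 * (1/5)^n) powr s)"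
    by (simp add: ennreal_mult ennreal_of_nat_eq_real_of_nat)
  finally show ?thesis .
qed

lemma cell_count_eq_growth:
  assumes "n > 0"
  shows "real (cell_count \<alpha> n) = (5 ^ n) powr growth_exponent \<alpha> n"
  using assms cell_count_pos[of \<alpha> n]
  by (simp add: powr_def growth_exponent_def ln_realpow)

text \<open>For t strictly between the limit inferior and s, infinitely many levels n have at most
  5^(n t) cells. Covering by the cells of such a level costs at most 2^s 5^(-n (s - t)), which is
  arbitrarily small.\<close>

lemma hausdorff_measure_Kcomp_zero:
  assumes "s > 0" "liminf (\<lambda>k. ereal (growth_exponent \<alpha> k)) < ereal s"
  shows "hausdorff_measure s (Kcomp \<alpha>) = 0"
proof -
  obtain t where t: "liminf (\<lambda>k. ereal (growth_exponent \<alpha> k)) < ereal t" "t < s"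
    using ereal_dense2[OF assms(2)] by auto
  have fr: "\<exists>n\<ge>m. growth_exponent \<alpha> n < t" for m
  proof (rule ccontr)
    assume "\<not> ?thesis"
    then have "eventually (\<lambda>n. ereal t \<le> ereal (growth_exponent \<alpha> n)) sequentially"
      unfolding eventually_sequentially by (intro exI[of _ m]) force
    then have "ereal t \<le> liminf (\<lambda>k. ereal (growth_exponent \<alpha> k))" by (rule Liminf_bounded)
    with t show False by simp
  qed
  have q: "(1/5::real) powr (s - t) < 1" using powr_less_mono2[of "s - t" "1/5" 1] t by simp
  have "hausdorff_pre s \<delta> (Kcomp \<alpha>) \<le> ennreal \<epsilon>" if "\<delta> > 0" "\<epsilon> > 0" for \<delta> \<epsilon>
  proof -
    have "eventually (\<lambda>n. 2 powr s * ((1/5) powr (s - t))^n < \<epsilon>) sequentially"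
      by (rule order_tendstoD[OF tendsto_mult_right_zero[OF LIMSEQ_realpow_zero]]) (use q that in auto)
    moreover have "eventually (\<lambda>n. 2 * (1/5)^n < \<delta>) sequentially"
      by (rule order_tendstoD[OF tendsto_mult_right_zero[OF LIMSEQ_realpow_zero]]) (use that in auto)
    ultimately have "eventually (\<lambda>n. 2 powr s * ((1/5) powr (s - t))^n < \<epsilon> \<and> 2 * (1/5)^n < \<delta>) sequentially"
      by eventually_elim simp
    then obtain m where m: "\<And>n. n \<ge> m \<Longrightarrow> 2 powr s * ((1/5) powr (s - t))^n < \<epsilon> \<and> 2 * (1/5)^n < \<delta>"
      unfolding eventually_sequentially by blast
    \<comment> \<open>Starting at \<open>Suc m\<close> ensures n > 0, where the cell count is
      recovered from its exponent.\<close>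
    obtain n where n: "n \<ge> Suc m" "growth_exponent \<alpha> n < t" using fr by blast
    have "real (cell_count \<alpha> n) \<le> (5^n) powr t"
      using n by (subst cell_count_eq_growth) (auto intro!: powr_mono)
    then have "real (cell_count \<alpha> n) * (2 * (1/5)^n) powr s \<le> (5^n) powr t * (2 * (1/5)^n) powr s"
      by (intro mult_right_mono) auto
    also have "\<dots> = 2 powr s * ((1/5) powr (s - t))^n"
    proof -
      have 5: "(1/5::real)^n = 5 powr - real n" "(5::real)^n = 5 powr real n" "(1/5::real) = 5 powr -1"
        by (simp_all add: powr_minus_divide powr_realpow power_divide)
      show ?thesis
        by (simp add: powr_mult 5(1,2) powr_powr powr_power flip: powr_add)
          (simp only: 5(3) powr_powr, simp add: powr_power algebra_simps flip: powr_add)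
    qed
    finally show ?thesis
      using hausdorff_pre_Kcomp_le[OF assms(1), of n \<delta> \<alpha>] m[of n] n
      by (meson Suc_leD ennreal_leI less_imp_le order_trans)
  qed
  then have "hausdorff_pre s \<delta> (Kcomp \<alpha>) = 0" if "\<delta> > 0" for \<delta>
    using that ennreal_le_epsilon[of 0 "hausdorff_pre s \<delta> (Kcomp \<alpha>)"]
    by (metis add_0 ennreal_le_epsilon le_zero_eq)
  then show ?thesis unfolding hausdorff_measure_def by (simp add: SUP_eq_const)
qed

lemma le_of_hausdorff_measure_Kcomp_zero:
  assumes "s > 0" "hausdorff_measure s (Kcomp \<alpha>) = 0"
  shows "liminf (\<lambda>k. ereal (growth_exponent \<alpha> k)) \<le> ereal s"
proof (rule ccontr)
  assume "\<not> ?thesis"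
  then have "eventually (\<lambda>k. ereal s < ereal (growth_exponent \<alpha> k)) sequentially"
    by (intro less_LiminfD) simp
  then obtain m where m: "\<And>n. n \<ge> m \<Longrightarrow> s < growth_exponent \<alpha> n"
    unfolding eventually_sequentially by auto
  \<comment> \<open>Beyond level m the count already exceeds 5^(n s). The constant absorbs the
    levels up to m, where the count is only known to be at least 1.\<close>
  define C where "C = (5^Suc m) powr s"
  have C: "C > 0" "C \<ge> 1"
    using assms(1) by (simp add: C_def, unfold C_def, intro ge_one_powr_ge_zero one_le_power) auto
  have "1 / real (cell_count \<alpha> n) \<le> C * ((1/5)^n) powr s" for n
  proof -
    have p: "((1/5::real)^n) powr s = 1 / (5^n) powr s"
      by (simp add: power_divide powr_divide)
    have "(5^n) powr s \<le> C * real (cell_count \<alpha> n)"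
    proof (cases "n \<ge> Suc m")
      case True
      then have "(5^n) powr s \<le> real (cell_count \<alpha> n)"
        using m[of n] by (subst cell_count_eq_growth) (auto intro!: powr_mono)
      also have "\<dots> \<le> C * real (cell_count \<alpha> n)"
        using mult_right_mono[OF C(2), of "real (cell_count \<alpha> n)"] by simp
      finally show ?thesis .
    next
      case False
      then have "((5::real)^n) powr s \<le> C"
        unfolding C_def using assms(1) by (intro powr_mono2 power_increasing) auto
      also have "\<dots> \<le> C * real (cell_count \<alpha> n)"
        using C cell_count_pos[of \<alpha> n] by simp
      finally show ?thesis .
    qed
    then show ?thesis unfolding p using cell_count_pos[of \<alpha> n] by (simp add: field_simps)
  qed
  then show False using hausdorff_measure_Kcomp_nonzero[OF assms(1) C(1)] assms(2) by blast
qed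

lemma growth_exponent_nonneg: "0 \<le> growth_exponent \<alpha> k"
  using cell_count_pos[of \<alpha> k] by (simp add: growth_exponent_def)

lemma hausdorff_dim_Kcomp:
  "hausdorff_dim (Kcomp \<alpha>) = liminf (\<lambda>k. ereal (growth_exponent \<alpha> k))" (is "_ = ?L")
proof (rule antisym)
  show "?L \<le> hausdorff_dim (Kcomp \<alpha>)"
    unfolding hausdorff_dim_def using le_of_hausdorff_measure_Kcomp_zero
    by (intro Inf_greatest) auto
  show "hausdorff_dim (Kcomp \<alpha>) \<le> ?L"
  proof (rule ccontr)
    assume "\<not> ?thesis"
    then obtain s where s: "?L < ereal s" "ereal s < hausdorff_dim (Kcomp \<alpha>)"
      using ereal_dense2[of ?L] by (auto simp: not_le)
    \<comment> \<open>The infimum defining \<open>hausdorff_dim\<close> ranges over positive s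
      only.\<close>
    have "0 \<le> ?L" by (intro Liminf_bounded) (simp add: growth_exponent_nonneg)
    then have "s > 0" using s(1) by (metis ereal_less(2) le_less_trans)
    then have "hausdorff_dim (Kcomp \<alpha>) \<le> ereal s"
      unfolding hausdorff_dim_def using hausdorff_measure_Kcomp_zero s(1) by (intro Inf_lower) auto
    with s show False by simp
  qed
qed

section \<open>Growth exponents and the frequency of zeros\<close>

lemma growth_exponent_eq:
  assumes "n > 0"
  shows "growth_exponent \<alpha> n = log 5 44 - lam \<alpha> n * (log 5 44 - log 5 13)"
proof -
  have "ln (real (cell_count \<alpha> n)) =
      real (card {j. j < n \<and> \<alpha> j = 0}) * ln 13 + (real n - real (card {j. j < n \<and> \<alpha> j = 0})) * ln 44"
  proof (induction n)
    case 0
    then show ?case by (simp add: cell_count_def)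
  next
    case (Suc n)
    have "{j. j < Suc n \<and> \<alpha> j = 0} = (if \<alpha> n = 0 then insert n {j. j < n \<and> \<alpha> j = 0} else {j. j < n \<and> \<alpha> j = 0})"
      by (auto simp: less_Suc_eq)
    moreover have "ln (real (cell_count \<alpha> (Suc n))) = ln (real (cell_count \<alpha> n)) + (if \<alpha> n = 0 then ln 13 else ln 44)"
      using cell_count_pos[of \<alpha> n] by (simp add: cell_count_def card_Dset ln_mult)
    ultimately show ?case unfolding Suc by (simp add: algebra_simps)
  qed
  then show ?thesis using assms by (simp add: growth_exponent_def lam_def log_def field_simps)
qed

lemma lam_bounds: "0 \<le> lam \<alpha> m" "lam \<alpha> m \<le> 1"
proof -
  have "card {j. j < m \<and> \<alpha> j = 0} \<le> card {..<m}" by (intro card_mono) auto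
  then show "0 \<le> lam \<alpha> m" "lam \<alpha> m \<le> 1" by (auto simp: lam_def divide_le_eq)
qed

text \<open>The identity fails at n = 0, hence holds only eventually. The sum with a negated product
  lets limits pass through addition, negation and scaling one at a time; the negation exchanges
  limit inferior and limit superior.\<close>

lemma growth_exponent_tail:
  "eventually (\<lambda>n. ereal (growth_exponent \<alpha> n) =
     ereal (log 5 44) + - (ereal (log 5 44 - log 5 13) * ereal (lam \<alpha> n))) sequentially"
  using eventually_gt_at_top[of 0] by eventually_elim (simp add: growth_exponent_eq)

lemma affine_eq_convex_combination:
  "ereal b + - (ereal (b - a) * ereal l) = ereal l * ereal a + (1 - ereal l) * ereal b"
  by (simp add: one_ereal_def algebra_simps)

lemma liminf_growth_exponent:
  "liminf (\<lambda>n. ereal (growth_exponent \<alpha> n)) =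
     limsup (\<lambda>m. ereal (lam \<alpha> m)) * ereal (log 5 13) + (1 - limsup (\<lambda>m. ereal (lam \<alpha> m))) * ereal (log 5 44)"
proof -
  let ?l = "limsup (\<lambda>m. ereal (lam \<alpha> m))"
  \<comment> \<open>Finiteness of the limit reduces the final rearrangement to real
    arithmetic.\<close>
  have "0 \<le> ?l" "?l \<le> 1"
    using lam_bounds[of \<alpha>] by (auto intro!: le_Limsup Limsup_bounded)
  then obtain l where l: "?l = ereal l" by (cases ?l) auto
  have "liminf (\<lambda>n. ereal (growth_exponent \<alpha> n)) =
      ereal (log 5 44) + - (ereal (log 5 44 - log 5 13) * ?l)"
    unfolding Liminf_eq[OF growth_exponent_tail]
    by (subst Liminf_add_ereal_left, simp, simp, subst ereal_Liminf_uminus,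
        subst Limsup_ereal_mult_left) simp_all
  then show ?thesis unfolding l affine_eq_convex_combination .
qed

lemma limsup_growth_exponent:
  "limsup (\<lambda>n. ereal (growth_exponent \<alpha> n)) =
     liminf (\<lambda>m. ereal (lam \<alpha> m)) * ereal (log 5 13) + (1 - liminf (\<lambda>m. ereal (lam \<alpha> m))) * ereal (log 5 44)"
proof -
  let ?l = "liminf (\<lambda>m. ereal (lam \<alpha> m))"
  have "0 \<le> ?l" "?l \<le> 1"
    using lam_bounds[of \<alpha>] by (auto intro!: Liminf_le Liminf_bounded)
  then obtain l where l: "?l = ereal l" by (cases ?l) auto
  have "limsup (\<lambda>n. ereal (growth_exponent \<alpha> n)) =
      ereal (log 5 44) + - (ereal (log 5 44 - log 5 13) * ?l)"
    unfolding Limsup_eq[OF growth_exponent_tail]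
    by (subst Limsup_add_ereal_left, simp, simp, subst ereal_Limsup_uminus,
        subst Liminf_ereal_mult_left) simp_all
  then show ?thesis unfolding l affine_eq_convex_combination .
qed

text \<open>The number of zeros among the first n symbols differs from n c / p by a bounded amount,
  where c is the number of zeros in a period of length p; division by n gives the limit c /
  p.\<close>

lemma preperiodic_lam_convergent:
  assumes "preperiodic \<alpha>"
  shows "convergent (lam \<alpha>)"
proof -
  obtain n0 p where p: "p > 0" "\<And>n. n \<ge> n0 \<Longrightarrow> \<alpha> (n + p) = \<alpha> n"
    using assms unfolding preperiodic_def by blast
  define Z :: "nat \<Rightarrow> real" where "Z n = (\<Sum>j<n. if \<alpha> j = 0 then 1 else 0)" for n
  have lam: "lam \<alpha> n = Z n / real n" for n
  proof -
    have "{j. j < n \<and> \<alpha> j = 0} = {j \<in> {..<n}. \<alpha> j = 0}" by auto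
    then show ?thesis by (simp add: lam_def Z_def sum.If_cases Int_def)
  qed
  define c where "c = Z (n0 + p) - Z n0"
  have c: "Z (n + p) - Z n = c" if "n \<ge> n0" for n
    using that
  proof (induction n rule: dec_induct)
    case (step n)
    then show ?case using p(2)[of n] by (simp add: Z_def)
  qed (simp add: c_def)
  define w where "w n = Z n - real n * (c / real p)" for n
  \<comment> \<open>Past the preperiod w repeats with period p, so stepping back by p reaches one of
    finitely many initial values.\<close>
  have "w n \<in> w ` {..<n0 + p}" for n
  proof (induction n rule: less_induct)
    case (less n)
    show ?case
    proof (cases "n < n0 + p")
      case False
      then have "w n = w (n - p)" using c[of "n - p"] p(1) by (simp add: w_def field_simps of_nat_diff)
      then show ?thesis using less[of "n - p"] False p(1) by simp
    qed simp
  qed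
  then have "range w \<subseteq> w ` {..<n0 + p}" by blast
  then have "bounded (range w)" by (meson bounded_subset finite_imageI finite_imp_bounded finite_lessThan)
  then obtain M where M: "\<And>n. \<bar>w n\<bar> \<le> M" unfolding bounded_iff by auto
  have "(\<lambda>n. w n * (1 / real n)) \<longlonglongrightarrow> 0"
  proof (rule Lim_null_comparison)
    show "eventually (\<lambda>n. norm (w n * (1 / real n)) \<le> M * (1 / real n)) sequentially"
      using M by (simp add: abs_mult divide_right_mono)
    show "(\<lambda>n. M * (1 / real n)) \<longlonglongrightarrow> 0" by (intro tendsto_mult_right_zero lim_1_over_n)
  qed
  then have "(\<lambda>n. w n * (1 / real n) + c / real p) \<longlonglongrightarrow> 0 + c / real p"
    by (intro tendsto_add tendsto_const)
  moreover have "eventually (\<lambda>n. w n * (1 / real n) + c / real p = lam \<alpha> n) sequentially"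
    using eventually_gt_at_top[of 0] by eventually_elim (simp add: w_def lam field_simps)
  ultimately have "lam \<alpha> \<longlonglongrightarrow> 0 + c / real p" by (rule Lim_transform_eventually)
  then show ?thesis unfolding convergent_def by blast
qed

theorem theorem4:
  fixes \<alpha> :: "nat \<Rightarrow> nat"
  assumes "\<forall>n. \<alpha> n \<in> {0, 1}"
  shows "lower_box_dim (Kcomp \<alpha>) =
           limsup (\<lambda>m. ereal (lam \<alpha> m)) * ereal (log 5 13)
           + (1 - limsup (\<lambda>m. ereal (lam \<alpha> m))) * ereal (log 5 44)
       \<and> upper_box_dim (Kcomp \<alpha>) =
           liminf (\<lambda>m. ereal (lam \<alpha> m)) * ereal (log 5 13)
           + (1 - liminf (\<lambda>m. ereal (lam \<alpha> m))) * ereal (log 5 44)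
       \<and> (preperiodic \<alpha> \<longrightarrow>
           hausdorff_dim (Kcomp \<alpha>) = ereal (lim (lam \<alpha>) * log 5 13 + (1 - lim (lam \<alpha>)) * log 5 44)
         \<and> lower_box_dim (Kcomp \<alpha>) = ereal (lim (lam \<alpha>) * log 5 13 + (1 - lim (lam \<alpha>)) * log 5 44)
         \<and> upper_box_dim (Kcomp \<alpha>) = ereal (lim (lam \<alpha>) * log 5 13 + (1 - lim (lam \<alpha>)) * log 5 44))"
proof (intro conjI impI)
  let ?a = "log 5 13" and ?b = "log 5 (44::real)"
  show lower: "lower_box_dim (Kcomp \<alpha>) =
      limsup (\<lambda>m. ereal (lam \<alpha> m)) * ereal ?a + (1 - limsup (\<lambda>m. ereal (lam \<alpha> m))) * ereal ?b"
    unfolding lower_box_dim_Kcomp by (rule liminf_growth_exponent)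
  show upper: "upper_box_dim (Kcomp \<alpha>) =
      liminf (\<lambda>m. ereal (lam \<alpha> m)) * ereal ?a + (1 - liminf (\<lambda>m. ereal (lam \<alpha> m))) * ereal ?b"
    unfolding upper_box_dim_Kcomp by (rule limsup_growth_exponent)
  assume "preperiodic \<alpha>"
  then have "lam \<alpha> \<longlonglongrightarrow> lim (lam \<alpha>)"
    using preperiodic_lam_convergent by (simp add: convergent_LIMSEQ_iff)
  then have "(\<lambda>m. ereal (lam \<alpha> m)) \<longlonglongrightarrow> ereal (lim (lam \<alpha>))" by simp
  then have l: "limsup (\<lambda>m. ereal (lam \<alpha> m)) = ereal (lim (lam \<alpha>))"
      "liminf (\<lambda>m. ereal (lam \<alpha> m)) = ereal (lim (lam \<alpha>))"
    by (simp_all add: lim_imp_Limsup lim_imp_Liminf)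
  show L: "lower_box_dim (Kcomp \<alpha>) = ereal (lim (lam \<alpha>) * ?a + (1 - lim (lam \<alpha>)) * ?b)"
    unfolding lower l by (simp add: one_ereal_def)
  show "upper_box_dim (Kcomp \<alpha>) = ereal (lim (lam \<alpha>) * ?a + (1 - lim (lam \<alpha>)) * ?b)"
    unfolding upper l by (simp add: one_ereal_def)
  \<comment> \<open>The Hausdorff and lower box dimensions are the same limit inferior of growth
    exponents.\<close>
  show "hausdorff_dim (Kcomp \<alpha>) = ereal (lim (lam \<alpha>) * ?a + (1 - lim (lam \<alpha>)) * ?b)"
    using L unfolding hausdorff_dim_Kcomp lower_box_dim_Kcomp .
qed

end
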